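(* Every centrally symmetric convex body $K$ in $\mathbb{R}^3$ admits an inscribed square based box, with any given ratio of the height to the basic edge, and centred at the centre of $K$. That is, for every real number $q>0$ there is a box with edge lengths $a,a,qa$ for some $a>0$, centred at the centre of $K$, all of whose vertices lie on the boundary of $K$.
   Context: A convex body is a compact convex set with non-empty interior. A box is a (non-degenerate) rectangular parallelepiped, in arbitrary orientation; a square based box has a square base (whose side is the basic edge) and a height orthogonal to it. A box is inscribed in $K$ if all its vertices lie on the boundary of $K$. *)

theory Defs
  imports "HOL-Analysis.Analysis"
begin

definition convex_body :: "(real ^ 3) set \<Rightarrow> bool" where
  "convex_body K \<longleftrightarrow> compact K \<and> convex K \<and> interior K \<noteq> {}"

definition symmetric_about :: "real ^ 3 \<Rightarrow> (real ^ 3) set \<Rightarrow> bool" where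
  "symmetric_about c K \<longleftrightarrow> (\<lambda>x. 2 *\<^sub>R c - x) ` K = K"

(* The solid parallelepiped with centre c and edge vectors u, v, w. *)
definition parallelepiped ::
    "real ^ 3 \<Rightarrow> real ^ 3 \<Rightarrow> real ^ 3 \<Rightarrow> real ^ 3 \<Rightarrow> (real ^ 3) set" where
  "parallelepiped c u v w =
     {c + r *\<^sub>R u + s *\<^sub>R v + t *\<^sub>R w | r s t.
        r \<in> {-1/2..1/2} \<and> s \<in> {-1/2..1/2} \<and> t \<in> {-1/2..1/2}}"

(* B is a box with centre c and edge lengths l, m, n, in arbitrary orientation.
   It is unrelated to the library's axis-parallel box and cbox. *)
definition box_with_edges ::
    "(real ^ 3) set \<Rightarrow> real ^ 3 \<Rightarrow> real \<Rightarrow> real \<Rightarrow> real \<Rightarrow> bool" where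
  "box_with_edges B c l m n \<longleftrightarrow> l > 0 \<and> m > 0 \<and> n > 0 \<and>
     (\<exists>u v w. orthogonal u v \<and> orthogonal u w \<and> orthogonal v w \<and>
        norm u = l \<and> norm v = m \<and> norm w = n \<and> B = parallelepiped c u v w)"

definition square_based_box ::
    "(real ^ 3) set \<Rightarrow> real ^ 3 \<Rightarrow> real \<Rightarrow> real \<Rightarrow> bool" where
  "square_based_box B c a h \<longleftrightarrow> box_with_edges B c a a h"

(* The vertices of a convex polytope are its extreme points. *)
definition inscribed :: "(real ^ 3) set \<Rightarrow> (real ^ 3) set \<Rightarrow> bool" where
  "inscribed B K \<longleftrightarrow> (\<forall>p. p extreme_point_of B \<longrightarrow> p \<in> frontier K)"

end

theory Submission
  imports Defs "HOL-Library.Z2"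
begin

text \<open>
Let \<open>f\<close> be the norm whose unit ball is \<open>K - c\<close>.  A box with orthonormal axes \<open>u\<close>, \<open>v\<close>, \<open>w\<close>, edge
ratio \<open>q\<close> and centre \<open>c\<close> can be scaled so as to be inscribed in \<open>K\<close> as soon as \<open>f\<close> takes the same
value at the four points \<open>\<plusminus>u \<plusminus> v + q w\<close>; the other four corners follow because \<open>f\<close> is even.
Let \<open>f1\<close>, \<open>f2\<close>, \<open>f3\<close>, \<open>f4\<close> be the values of \<open>f\<close> at these points, in cyclic order.  What is
sought is a zero of \<open>G = (f1 - f3, f2 - f4, f1 - f2 + f3 - f4)\<close> on the space of orthonormal frames.
The rotations that preserve a square based box form a dihedral group of order 8.  It acts freely on the
frames, and \<open>G\<close> is equivariant for an action on the target by signed permutations of the coordinates.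

Euler angles \<open>(a, t, b)\<close> make the cube \<open>[0, \<pi>] \<times> [0, \<pi>] \<times> [0, \<pi>/2]\<close> a fundamental domain.  Its
faces \<open>b = 0\<close> and \<open>b = \<pi>/2\<close> are identified by a quarter turn of the base, its faces \<open>a = 0\<close> and
\<open>a = \<pi>\<close> by turning the box upside down, and on the faces \<open>t = 0\<close> and \<open>t = \<pi>\<close> the frame depends
only on \<open>a + b\<close> and on \<open>a - b\<close>.  If \<open>G\<close> had no zero, its restriction to the boundary of the cube would
have degree 0, since it extends over the cube.  The identifications force this degree to be odd:
adding the counts over a pair of identified faces leaves a count of crossings along the edges of the cube, and
the edges combine to a count at vertices whose value is 1 (lemma \<open>no_equivariant_labelling\<close>).

The argument is carried out on a fine grid, in the manner of the lemmas of Sperner and Tucker.  Each grid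
point is labelled by a vertex of the octahedron, namely a signed coordinate axis along which \<open>G\<close> is
large; by uniform continuity no two points of a small cube get opposite labels.  So the labels define a
simplicial map to the octahedron, and its degree modulo 2 is the number of triangles mapped onto
a fixed face of it (lemma \<open>equivariant_map_has_zero\<close>).
\<close>

section \<open>The octahedron and its cochains modulo 2\<close>

text \<open>
The vertices of the octahedron are the positive and negative unit vectors on the three axes.
\<close>

datatype oct_vertex = P1 | N1 | P2 | N2 | P3 | N3

fun antipode :: "oct_vertex \<Rightarrow> oct_vertex" where
  "antipode P1 = N1" | "antipode N1 = P1" | "antipode P2 = N2" | "antipode N2 = P2" |
  "antipode P3 = N3" | "antipode N3 = P3"

text \<open>
How the quarter turn of the base acts on the labels: this is the linear map
\<open>(x, y, z) \<mapsto> (y, -x, -z)\<close>.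
\<close>

fun rot :: "oct_vertex \<Rightarrow> oct_vertex" where
  "rot P1 = N2" | "rot N1 = P2" | "rot P2 = P1" | "rot N2 = N1" | "rot P3 = N3" | "rot N3 = P3"

text \<open>
A half turn of the box about a diagonal of its middle square acts on the labels by the linear map
\<open>(x, y, z) \<mapsto> (-x, y, z)\<close>.
\<close>

fun mirror :: "oct_vertex \<Rightarrow> oct_vertex" where
  "mirror P1 = N1" | "mirror N1 = P1" | "mirror P2 = P2" | "mirror N2 = N2" |
  "mirror P3 = P3" | "mirror N3 = N3"

text \<open>
A set of vertices of the octahedron lies in a common face if and only if it has no antipodal pair.
\<close>

definition no_antipodes :: "oct_vertex set \<Rightarrow> bool" where
  "no_antipodes S \<longleftrightarrow> (\<forall>x\<in>S. antipode x \<notin> S)"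

text \<open>
Only parities of counts matter, hence the values in the field with two elements.  Orientations do not
matter either, so the three labels may come in any order.
\<close>

definition hits_triangle
    :: "oct_vertex \<Rightarrow> oct_vertex \<Rightarrow> oct_vertex \<Rightarrow> oct_vertex \<Rightarrow> oct_vertex \<Rightarrow> oct_vertex \<Rightarrow> bit" where
  "hits_triangle a b c p q s = of_bool (a \<in> {p,q,s} \<and> b \<in> {p,q,s} \<and> c \<in> {p,q,s})"

definition hits_edge :: "oct_vertex \<Rightarrow> oct_vertex \<Rightarrow> oct_vertex \<Rightarrow> oct_vertex \<Rightarrow> bit" where
  "hits_edge a b p q = of_bool (a \<in> {p,q} \<and> b \<in> {p,q})"

text \<open>
The face of the octahedron over which the degree is counted.
\<close>

abbreviation octant where "octant \<equiv> hits_triangle P1 P2 P3"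

text \<open>
Sums of bits are to be normalised as sums in a commutative group in which every element is its own
inverse, not rewritten to parities.
\<close>

declare add_bit_eq_xor [simp del]

lemma add_self: "x + x = (0::bit)"
  by (cases x) simp_all

lemma add_self_left: "x + (x + y) = (y::bit)"
  by (simp add: add.assoc [symmetric] add_self)

lemma no_antipodes_mono: "no_antipodes T \<Longrightarrow> S \<subseteq> T \<Longrightarrow> no_antipodes S"
  unfolding no_antipodes_def by blast

lemma no_antipodes_imageI: "(\<And>t t'. t \<in> D \<Longrightarrow> t' \<in> D \<Longrightarrow> antipode (f t) \<noteq> f t') \<Longrightarrow> no_antipodes (f ` D)"
  by (auto simp: no_antipodes_def)

lemma no_antipodes_pigeonhole:
  assumes "no_antipodes {p,q,s,u}"
  shows "p = q \<or> p = s \<or> p = u \<or> q = s \<or> q = u \<or> s = u"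
  using assms unfolding no_antipodes_def
  by (cases p; cases q; (simp; fail)?; cases s; (simp; fail)?; cases u; simp)

lemma hits_triangle_degenerate:
  assumes "a \<noteq> b" "a \<noteq> c" "b \<noteq> c"
  shows "hits_triangle a b c p p s = 0" "hits_triangle a b c p s p = 0" "hits_triangle a b c s p p = 0"
  using assms unfolding hits_triangle_def by auto

lemma hits_triangle_commute: "hits_triangle a b c p q s = hits_triangle a b c q p s"
    "hits_triangle a b c p q s = hits_triangle a b c p s q"
  by (auto simp: hits_triangle_def)

text \<open>
A tetrahedron is mapped into a face of the octahedron, which has only three vertices; hence two of its
vertices have the same label, and the two triangles opposite to them cancel, while the other two are
degenerate.
\<close>

lemma octant_cocycle:
  assumes "no_antipodes {p,q,s,u}"
  shows "octant p q s + octant p q u + octant p s u + octant q s u = 0"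
proof -
  have d: "octant x x y = 0" "octant x y x = 0" "octant y x x = 0" for x y
    by (simp_all add: hits_triangle_degenerate)
  show ?thesis
    using no_antipodes_pigeonhole [OF assms]
    by (elim disjE) (simp_all add: d add_self hits_triangle_commute)
qed

text \<open>
Two adjacent faces of the octahedron differ by the coboundary of their common edge: the vertices joined to
both ends of an edge are exactly the third vertices of these two faces.  This is what makes the count over
two identified faces of the cube depend on their boundary alone.
\<close>

lemma octants_differ_by_edge1:
  assumes "no_antipodes {p,q,s}"
  shows "octant p q s + hits_triangle N1 P2 P3 p q s = hits_edge P2 P3 p q + hits_edge P2 P3 q s
      + hits_edge P2 P3 p s"
  using assms unfolding no_antipodes_def hits_triangle_def hits_edge_def
  by (cases p; cases q; cases s; simp)

lemma octants_differ_by_edge2: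
  assumes "no_antipodes {p,q,s}"
  shows "hits_triangle N1 P2 P3 p q s + hits_triangle N1 P2 N3 p q s = hits_edge N1 P2 p q
      + hits_edge N1 P2 q s + hits_edge N1 P2 p s"
  using assms unfolding no_antipodes_def hits_triangle_def hits_edge_def
  by (cases p; cases q; cases s; simp)

text \<open>
The eight edges are exactly those of the octahedron that join \<open>{P2, N2, N3}\<close> to its complement.
They are what is left of the boundary of the cube in the final count.
\<close>

lemma link_edges_sum:
  assumes "no_antipodes {p,q}"
  shows "hits_edge P2 P3 p q + hits_edge N2 P3 p q + (hits_edge N1 P2 p q + hits_edge P1 P2 p q)
     + (hits_edge N1 N3 p q + hits_edge P1 N3 p q) + (hits_edge N1 N2 p q + hits_edge P1 N2 p q)
    = of_bool (p \<in> {P2,N2,N3}) + of_bool (q \<in> {P2,N2,N3})"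
  using assms unfolding no_antipodes_def hits_edge_def
  by (cases p; cases q; simp)

section \<open>Stokes formulas for labelled grids\<close>

text \<open>
A unit square is cut by its diagonal in the direction \<open>(1, 1)\<close>.  This choice is invariant under point
reflection, which is how two of the faces of the cube are identified.
\<close>

definition square_sum
    :: "(oct_vertex \<Rightarrow> oct_vertex \<Rightarrow> oct_vertex \<Rightarrow> bit) \<Rightarrow> (nat \<Rightarrow> nat \<Rightarrow> oct_vertex) \<Rightarrow> nat \<Rightarrow> nat \<Rightarrow> bit" where
  "square_sum w M i j = w (M i j) (M (Suc i) j) (M (Suc i) (Suc j)) + w (M i j) (M i (Suc j)) (M (Suc i) (Suc j))"

text \<open>
The unit cube is the union of the six tetrahedra of monotone lattice paths from \<open>(i, j, k)\<close> to
\<open>(i + 1, j + 1, k + 1)\<close>.  Summing the cocycle relation over them cancels the triangles that contain the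
long diagonal and leaves those of the six square faces.
\<close>

lemma cube_boundary:
  assumes "no_antipodes ((\<lambda>(i, j, k). L i j k) ` ({i, Suc i} \<times> {j, Suc j} \<times> {k, Suc k}))"
  shows "(square_sum octant (L i) j k + square_sum octant (L (Suc i)) j k)
    + (square_sum octant (\<lambda>i. L i j) i k + square_sum octant (\<lambda>i. L i (Suc j)) i k)
    + (square_sum octant (\<lambda>i j. L i j k) i j + square_sum octant (\<lambda>i j. L i j (Suc k)) i j) = 0"
proof -
  let ?o = "L i j k" and ?e = "L (Suc i) (Suc j) (Suc k)"
  \<comment> \<open>\<open>x\<close> and \<open>y\<close> are the labels at the two inner points of a monotone path\<close>
  have T: "octant ?o x y + octant ?o x ?e + octant ?o y ?e + octant x y ?e = 0"
    if "(x, y) \<in> {(L (Suc i) j k, L (Suc i) (Suc j) k), (L (Suc i) j k, L (Suc i) j (Suc k)),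
      (L i (Suc j) k, L (Suc i) (Suc j) k), (L i (Suc j) k, L i (Suc j) (Suc k)),
      (L i j (Suc k), L (Suc i) j (Suc k)), (L i j (Suc k), L i (Suc j) (Suc k))}" for x y
  proof -
    have "no_antipodes {?o, x, y, ?e}"
      by (rule no_antipodes_mono [OF assms]) (use that in auto)
    from octant_cocycle [OF this] show ?thesis by (simp add: ac_simps)
  qed
  note TT = T [of "L (Suc i) j k" "L (Suc i) (Suc j) k"] T [of "L (Suc i) j k" "L (Suc i) j (Suc k)"]
    T [of "L i (Suc j) k" "L (Suc i) (Suc j) k"] T [of "L i (Suc j) k" "L i (Suc j) (Suc k)"]
    T [of "L i j (Suc k)" "L (Suc i) j (Suc k)"] T [of "L i j (Suc k)" "L i (Suc j) (Suc k)"]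
  have "?thesis \<longleftrightarrow> (\<Sum>(x, y)\<leftarrow>[(L (Suc i) j k, L (Suc i) (Suc j) k), (L (Suc i) j k, L (Suc i) j (Suc k)),
      (L i (Suc j) k, L (Suc i) (Suc j) k), (L i (Suc j) k, L i (Suc j) (Suc k)),
      (L i j (Suc k), L (Suc i) j (Suc k)), (L i j (Suc k), L i (Suc j) (Suc k))].
      octant ?o x y + octant ?o x ?e + octant ?o y ?e + octant x y ?e) = 0"
    unfolding square_sum_def
    by (simp only: list.map sum_list.Cons sum_list.Nil split_conv ac_simps add_self_left add.right_neutral add.left_neutral)
  also have "\<dots>" using TT by simp
  finally show ?thesis by simp
qed

lemma sum_telescope_bit: "(\<Sum>i<n. f i + f (Suc i)) = f 0 + (f n :: bit)"
  by (induction n) (simp_all add: add_self add_self_left ac_simps)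

definition edge_count :: "oct_vertex \<Rightarrow> oct_vertex \<Rightarrow> (nat \<Rightarrow> oct_vertex) \<Rightarrow> nat \<Rightarrow> bit" where
  "edge_count a b g n = (\<Sum>i<n. hits_edge a b (g i) (g (Suc i)))"

definition triangle_count
    :: "(oct_vertex \<Rightarrow> oct_vertex \<Rightarrow> oct_vertex \<Rightarrow> bit) \<Rightarrow> (nat \<Rightarrow> nat \<Rightarrow> oct_vertex) \<Rightarrow> nat \<Rightarrow> nat \<Rightarrow> bit" where
  "triangle_count w M I J = (\<Sum>i<I. \<Sum>j<J. square_sum w M i j)"

text \<open>
Diagonals and inner grid edges belong to two triangles each, so only the boundary of the rectangle remains.
\<close>

lemma triangle_count_boundary:
  assumes no_antipodes: "\<And>i j. i < I \<Longrightarrow> j < J \<Longrightarrow> no_antipodes ((\<lambda>(i, j). M i j) ` ({i, Suc i} \<times> {j, Suc j}))"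
    and cochain: "\<And>p q s. no_antipodes {p,q,s} \<Longrightarrow> w p q s + w' p q s = hits_edge a b p q + hits_edge a b q s
        + hits_edge a b p s"
  shows "triangle_count w M I J + triangle_count w' M I J
    = edge_count a b (M 0) J + edge_count a b (M I) J + edge_count a b (\<lambda>i. M i 0) I
        + edge_count a b (\<lambda>i. M i J) I"
proof -
  define X where "X i j = hits_edge a b (M i j) (M i (Suc j))" for i j
  define Y where "Y i j = hits_edge a b (M i j) (M (Suc i) j)" for i j
  have sq: "square_sum w M i j + square_sum w' M i j = (X i j + X (Suc i) j) + (Y i j + Y i (Suc j))"
    if "i < I" "j < J" for i j
  proof -
    have "w p q s + w' p q s = hits_edge a b p q + hits_edge a b q s + hits_edge a b p s"
      if "(p, q, s) \<in> {(M i j, M (Suc i) j, M (Suc i) (Suc j)), (M i j, M i (Suc j), M (Suc i) (Suc j))}" for p q s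
      by (rule cochain, rule no_antipodes_mono [OF no_antipodes [OF \<open>i < I\<close> \<open>j < J\<close>]]) (use that in auto)
    from this [of "M i j" "M (Suc i) j" "M (Suc i) (Suc j)"] this [of "M i j" "M i (Suc j)" "M (Suc i) (Suc j)"]
    have e: "w (M i j) (M (Suc i) j) (M (Suc i) (Suc j)) + w' (M i j) (M (Suc i) j) (M (Suc i) (Suc j))
        = hits_edge a b (M i j) (M (Suc i) j) + hits_edge a b (M (Suc i) j) (M (Suc i) (Suc j))
            + hits_edge a b (M i j) (M (Suc i) (Suc j))"
      "w (M i j) (M i (Suc j)) (M (Suc i) (Suc j)) + w' (M i j) (M i (Suc j)) (M (Suc i) (Suc j))
        = hits_edge a b (M i j) (M i (Suc j)) + hits_edge a b (M i (Suc j)) (M (Suc i) (Suc j))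
            + hits_edge a b (M i j) (M (Suc i) (Suc j))"
      by blast+
    have "square_sum w M i j + square_sum w' M i j
      = (w (M i j) (M (Suc i) j) (M (Suc i) (Suc j)) + w' (M i j) (M (Suc i) j) (M (Suc i) (Suc j)))
      + (w (M i j) (M i (Suc j)) (M (Suc i) (Suc j)) + w' (M i j) (M i (Suc j)) (M (Suc i) (Suc j)))"
      unfolding square_sum_def by (simp only: ac_simps)
    also have "\<dots> = (X i j + X (Suc i) j) + (Y i j + Y i (Suc j))"
      unfolding e X_def Y_def by (simp only: ac_simps add_self_left add_self add.right_neutral)
    finally show ?thesis .
  qed
  have "triangle_count w M I J + triangle_count w' M I J = (\<Sum>i<I. \<Sum>j<J. (X i j + X (Suc i) j)
      + (Y i j + Y i (Suc j)))"
    unfolding triangle_count_def sum.distrib [symmetric] using sq by (intro sum.cong refl) simp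
  also have "\<dots> = (\<Sum>i<I. (\<Sum>j<J. X i j) + (\<Sum>j<J. X (Suc i) j)) + (\<Sum>i<I. \<Sum>j<J. Y i j + Y i (Suc j))"
    by (simp only: sum.distrib)
  also have "\<dots> = ((\<Sum>j<J. X 0 j) + (\<Sum>j<J. X I j)) + ((\<Sum>i<I. Y i 0) + (\<Sum>i<I. Y i J))"
    unfolding sum_telescope_bit [of "\<lambda>i. \<Sum>j<J. X i j"] sum_telescope_bit [of "Y i" for i]
    by (simp only: sum.distrib)
  finally show ?thesis
    unfolding edge_count_def X_def Y_def by (simp only: ac_simps)
qed

lemma box_boundary:
  assumes no_antipodes: "\<And>i j k. i < I \<Longrightarrow> j < J \<Longrightarrow> k < K \<Longrightarrow>
    no_antipodes ((\<lambda>(i, j, k). L i j k) ` ({i, Suc i} \<times> {j, Suc j} \<times> {k, Suc k}))"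
  shows "(triangle_count octant (L 0) J K + triangle_count octant (L I) J K)
    + (triangle_count octant (\<lambda>i. L i 0) I K + triangle_count octant (\<lambda>i. L i J) I K)
    + (triangle_count octant (\<lambda>i j. L i j 0) I J + triangle_count octant (\<lambda>i j. L i j K) I J) = 0"
proof -
  define X where "X i j k = square_sum octant (L i) j k" for i j k
  define Y where "Y j i k = square_sum octant (\<lambda>i. L i j) i k" for i j k
  define Z where "Z k i j = square_sum octant (\<lambda>i j. L i j k) i j" for i j k
  have "0 = (\<Sum>i<I. \<Sum>j<J. \<Sum>k<K. (X i j k + X (Suc i) j k) + (Y j i k + Y (Suc j) i k)
      + (Z k i j + Z (Suc k) i j))"
    unfolding X_def Y_def Z_def using cube_boundary [OF no_antipodes]
    by (intro sum.neutral [symmetric] ballI) simp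
  also have "\<dots> = (\<Sum>i<I. (\<Sum>j<J. \<Sum>k<K. X i j k) + (\<Sum>j<J. \<Sum>k<K. X (Suc i) j k))
      + (\<Sum>i<I. \<Sum>j<J. (\<Sum>k<K. Y j i k) + (\<Sum>k<K. Y (Suc j) i k))
      + (\<Sum>i<I. \<Sum>j<J. \<Sum>k<K. Z k i j + Z (Suc k) i j)"
    by (simp only: sum.distrib)
  also have "\<dots> = ((\<Sum>j<J. \<Sum>k<K. X 0 j k) + (\<Sum>j<J. \<Sum>k<K. X I j k))
      + (\<Sum>i<I. (\<Sum>k<K. Y 0 i k) + (\<Sum>k<K. Y J i k))
      + (\<Sum>i<I. \<Sum>j<J. Z 0 i j + Z K i j)"
    unfolding sum_telescope_bit [of "\<lambda>i. \<Sum>j<J. \<Sum>k<K. X i j k"]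
      sum_telescope_bit [of "\<lambda>j. \<Sum>k<K. Y j i k" for i] sum_telescope_bit [of "\<lambda>k. Z k i j" for i j] ..
  finally show ?thesis
    unfolding X_def Y_def Z_def triangle_count_def by (simp only: sum.distrib)
qed

lemma triangle_count_cong:
  assumes "\<And>i j. i \<le> I \<Longrightarrow> j \<le> J \<Longrightarrow> M i j = M' i j"
  shows "triangle_count w M I J = triangle_count w M' I J"
  unfolding triangle_count_def square_sum_def using assms by (intro sum.cong refl) auto

lemma edge_count_cong:
  assumes "\<And>i. i \<le> n \<Longrightarrow> g i = g' i"
  shows "edge_count a b g n = edge_count a b g' n"
  unfolding edge_count_def using assms by (intro sum.cong refl) auto

lemma hits_edge_commute: "hits_edge a b p q = hits_edge a b q p"
  by (auto simp: hits_edge_def)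

lemma edge_count_rev: "edge_count a b (\<lambda>i. g (n - i)) n = edge_count a b g n"
proof -
  have "edge_count a b g n = (\<Sum>i<n. hits_edge a b (g (n - Suc i)) (g (Suc (n - Suc i))))"
    unfolding edge_count_def by (rule sum.nat_diff_reindex [symmetric])
  also have "\<dots> = edge_count a b (\<lambda>i. g (n - i)) n"
    unfolding edge_count_def by (intro sum.cong refl) (auto simp: Suc_diff_Suc hits_edge_commute)
  finally show ?thesis by simp
qed

lemma edge_count_add: "edge_count a b g (m + n) = edge_count a b g m + edge_count a b (\<lambda>i. g (m + i)) n"
proof -
  have "(\<Sum>i<m + n. h i) = (\<Sum>i<m. h i) + (\<Sum>i<n. (h (m + i) :: bit))" for h
    by (induction n) (simp_all add: ac_simps)
  then show ?thesis by (simp add: edge_count_def)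
qed

lemma triangle_count_rev:
  "triangle_count (hits_triangle a b c) (\<lambda>i j. M (I - i) (J - j)) I J
      = triangle_count (hits_triangle a b c) M I J"
proof -
  have "square_sum (hits_triangle a b c) (\<lambda>i j. M (I - i) (J - j)) i j
      = square_sum (hits_triangle a b c) M (I - Suc i) (J - Suc j)"
    if "i < I" "j < J" for i j
    using that by (simp add: square_sum_def Suc_diff_Suc hits_triangle_commute ac_simps)
  then have "triangle_count (hits_triangle a b c) (\<lambda>i j. M (I - i) (J - j)) I J
    = (\<Sum>i<I. \<Sum>j<J. square_sum (hits_triangle a b c) M (I - Suc i) (J - Suc j))"
    unfolding triangle_count_def by (intro sum.cong refl) auto
  also have "\<dots> = triangle_count (hits_triangle a b c) M I J"
    unfolding triangle_count_def
    by (simp only: sum.nat_diff_reindex [where g = "\<lambda>j. square_sum (hits_triangle a b c) M _ j"]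
      sum.nat_diff_reindex [where g = "\<lambda>i. \<Sum>j<J. square_sum (hits_triangle a b c) M i j"])
  finally show ?thesis .
qed

lemma triangle_count_map:
  assumes "inj h"
  shows "triangle_count (hits_triangle (h a) (h b) (h c)) (\<lambda>i j. h (M i j)) I J
      = triangle_count (hits_triangle a b c) M I J"
  unfolding triangle_count_def square_sum_def hits_triangle_def by (simp add: inj_eq [OF assms])

lemma edge_count_map:
  assumes "inj h"
  shows "edge_count (h a) (h b) (\<lambda>i. h (g i)) n = edge_count a b g n"
  unfolding edge_count_def hits_edge_def by (simp add: inj_eq [OF assms])

lemma edge_count_swap: "edge_count a b g n = edge_count b a g n"
  unfolding edge_count_def by (intro sum.cong refl) (auto simp: hits_edge_def)

lemma inj_rot: "inj rot"
  by (rule injI, case_tac x; case_tac y; simp)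

lemma inj_mirror: "inj mirror"
  by (rule injI, case_tac x; case_tac y; simp)

section \<open>A labelled cube with identified faces\<close>

text \<open>
The index \<open>(i, j, k)\<close> runs over a grid on the cube of Euler angles \<open>(a, t, b)\<close>, and the hypotheses are
the identifications of its faces; \<open>bot\<close> and \<open>top\<close> are the labels on the two faces that collapse to a
circle.  The number of triangles labelled \<open>P1\<close>, \<open>P2\<close>, \<open>P3\<close> on the boundary of the cube is even.
The two collapsed faces contribute an even number; each of the other two pairs contributes
edge counts along its boundary.  All the edges in the \<open>t\<close> direction carry the same labels up to symmetry, and
their contributions cancel.  The edges on the collapsed faces are all images of the path
\<open>bot 0, \<dots>, bot n\<close>, whose end is the image of its start under \<open>rot\<close>.  They
add up to the number of steps at which this path enters or leaves \<open>{P2, N2, N3}\<close>; it is odd because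
\<open>rot\<close> exchanges this set with its complement.
\<close>

lemma no_equivariant_labelling:
  fixes L :: "nat \<Rightarrow> nat \<Rightarrow> nat \<Rightarrow> oct_vertex" and bot top :: "nat \<Rightarrow> oct_vertex"
  assumes "0 < n" "0 < m"
    and no_antipodes: "\<And>i j k. i < 2 * n \<Longrightarrow> j < m \<Longrightarrow> k < n \<Longrightarrow>
      no_antipodes ((\<lambda>(i, j, k). L i j k) ` ({i, Suc i} \<times> {j, Suc j} \<times> {k, Suc k}))"
    and rot: "\<And>i j. i \<le> 2 * n \<Longrightarrow> j \<le> m \<Longrightarrow> L i j n = rot (L i j 0)"
    and mirror: "\<And>j k. j \<le> m \<Longrightarrow> k \<le> n \<Longrightarrow> L (2 * n) j k = mirror (L 0 (m - j) (n - k))"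
    and bot: "\<And>i k. i \<le> 2 * n \<Longrightarrow> k \<le> n \<Longrightarrow> L i 0 k = bot (i + k)"
    and top: "\<And>i k. i \<le> 2 * n \<Longrightarrow> k \<le> n \<Longrightarrow> L i m k = top (i + n - k)"
  shows False
proof -
  \<comment> \<open>On the face \<open>j = 0\<close> the labels are constant in one diagonal direction, and the two triangles of each
    square have the same labels; on \<open>j = m\<close> they are constant in the other
    one, and every triangle has a repeated label.\<close>
  have bot0: "triangle_count octant (\<lambda>i. L i 0) (2 * n) n = 0"
  proof -
    have "triangle_count octant (\<lambda>i. L i 0) (2 * n) n = triangle_count octant (\<lambda>i k. bot (i + k)) (2 * n) n"
      by (rule triangle_count_cong) (simp add: bot)
    also have "\<dots> = 0"
      unfolding triangle_count_def square_sum_def by (simp add: add_self)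
    finally show ?thesis .
  qed
  have top0: "triangle_count octant (\<lambda>i. L i m) (2 * n) n = 0"
  proof -
    have "triangle_count octant (\<lambda>i. L i m) (2 * n) n
        = triangle_count octant (\<lambda>i k. top (i + n - k)) (2 * n) n"
      by (rule triangle_count_cong) (simp add: top)
    also have "\<dots> = 0"
      unfolding triangle_count_def square_sum_def by (intro sum.neutral ballI) (simp add: hits_triangle_degenerate)
    finally show ?thesis .
  qed
  let ?A = "L 0" and ?B = "\<lambda>i j. L i j 0"
  have A: "triangle_count octant ?A m n + triangle_count octant (L (2 * n)) m n =
    edge_count P2 P3 (?A 0) n + edge_count P2 P3 (?A m) n + edge_count P2 P3 (\<lambda>j. ?A j 0) m
        + edge_count P2 P3 (\<lambda>j. ?A j n) m"
  proof -
    have "triangle_count octant (L (2 * n)) m n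
        = triangle_count (hits_triangle P1 P2 P3) (\<lambda>j k. mirror (?A (m - j) (n - k))) m n"
      by (rule triangle_count_cong) (simp add: mirror)
    also have "\<dots> = triangle_count (hits_triangle N1 P2 P3) (\<lambda>j k. ?A (m - j) (n - k)) m n"
      using triangle_count_map [OF inj_mirror, of N1 P2 P3] by simp
    also have "\<dots> = triangle_count (hits_triangle N1 P2 P3) ?A m n" by (rule triangle_count_rev)
    finally have eq: "triangle_count octant (L (2 * n)) m n
        = triangle_count (hits_triangle N1 P2 P3) ?A m n" .
    have sp: "no_antipodes ((\<lambda>(j, k). ?A j k) ` ({j, Suc j} \<times> {k, Suc k}))" if "j < m" "k < n" for j k
      by (rule no_antipodes_mono [OF no_antipodes [of 0 j k]]) (use that \<open>0 < n\<close> in auto)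
    show ?thesis unfolding eq using triangle_count_boundary [OF sp octants_differ_by_edge1] by (simp add: ac_simps)
  qed
  \<comment> \<open>The quarter turn moves the chosen face of the octahedron to one that is two edges away.\<close>
  have B: "triangle_count octant ?B (2 * n) m + triangle_count octant (\<lambda>i j. L i j n) (2 * n) m =
    (edge_count P2 P3 (?B 0) m + edge_count P2 P3 (?B (2 * n)) m
      + edge_count P2 P3 (\<lambda>i. ?B i 0) (2 * n) + edge_count P2 P3 (\<lambda>i. ?B i m) (2 * n))
    + (edge_count N1 P2 (?B 0) m + edge_count N1 P2 (?B (2 * n)) m
      + edge_count N1 P2 (\<lambda>i. ?B i 0) (2 * n) + edge_count N1 P2 (\<lambda>i. ?B i m) (2 * n))"
  proof -
    have "triangle_count octant (\<lambda>i j. L i j n) (2 * n) m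
        = triangle_count (hits_triangle P1 P2 P3) (\<lambda>i j. rot (?B i j)) (2 * n) m"
      by (rule triangle_count_cong) (simp add: rot)
    also have "\<dots> = triangle_count (hits_triangle P2 N1 N3) ?B (2 * n) m"
      using triangle_count_map [OF inj_rot, of P2 N1 N3] by simp
    also have "\<dots> = triangle_count (hits_triangle N1 P2 N3) ?B (2 * n) m"
      by (simp add: hits_triangle_def triangle_count_def square_sum_def conj_ac)
    finally have eq: "triangle_count octant (\<lambda>i j. L i j n) (2 * n) m
        = triangle_count (hits_triangle N1 P2 N3) ?B (2 * n) m" .
    have sp: "no_antipodes ((\<lambda>(i, j). ?B i j) ` ({i, Suc i} \<times> {j, Suc j}))" if "i < 2 * n" "j < m" for i j
      by (rule no_antipodes_mono [OF no_antipodes [of i j 0]]) (use that \<open>0 < n\<close> in auto)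
    have "triangle_count octant ?B (2 * n) m + triangle_count (hits_triangle N1 P2 N3) ?B (2 * n) m
      = (triangle_count octant ?B (2 * n) m + triangle_count (hits_triangle N1 P2 P3) ?B (2 * n) m)
        + (triangle_count (hits_triangle N1 P2 P3) ?B (2 * n) m
            + triangle_count (hits_triangle N1 P2 N3) ?B (2 * n) m)"
      by (simp only: ac_simps add_self_left)
    also have "triangle_count octant ?B (2 * n) m + triangle_count (hits_triangle N1 P2 P3) ?B (2 * n) m
      = edge_count P2 P3 (?B 0) m + edge_count P2 P3 (?B (2 * n)) m
      + edge_count P2 P3 (\<lambda>i. ?B i 0) (2 * n) + edge_count P2 P3 (\<lambda>i. ?B i m) (2 * n)"
      using sp octants_differ_by_edge1 by (rule triangle_count_boundary)
    also have "triangle_count (hits_triangle N1 P2 P3) ?B (2 * n) m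
        + triangle_count (hits_triangle N1 P2 N3) ?B (2 * n) m
      = edge_count N1 P2 (?B 0) m + edge_count N1 P2 (?B (2 * n)) m
      + edge_count N1 P2 (\<lambda>i. ?B i 0) (2 * n) + edge_count N1 P2 (\<lambda>i. ?B i m) (2 * n)"
      using sp octants_differ_by_edge2 by (rule triangle_count_boundary)
    finally show ?thesis unfolding eq .
  qed
  have total: "(edge_count P2 P3 (?A 0) n + edge_count P2 P3 (?A m) n + edge_count P2 P3 (\<lambda>j. ?A j 0) m
      + edge_count P2 P3 (\<lambda>j. ?A j n) m)
    + ((edge_count P2 P3 (?B 0) m + edge_count P2 P3 (?B (2 * n)) m
      + edge_count P2 P3 (\<lambda>i. ?B i 0) (2 * n) + edge_count P2 P3 (\<lambda>i. ?B i m) (2 * n))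
    + (edge_count N1 P2 (?B 0) m + edge_count N1 P2 (?B (2 * n)) m
      + edge_count N1 P2 (\<lambda>i. ?B i 0) (2 * n) + edge_count N1 P2 (\<lambda>i. ?B i m) (2 * n))) = 0"
    using box_boundary [OF no_antipodes, of "2 * n" m n, unfolded bot0 top0 A B] by simp
  \<comment> \<open>The four edges in direction \<open>j\<close> are images of the path \<open>P\<close>.\<close>
  define P where "P j = L 0 j 0" for j
  have v1: "edge_count a b (\<lambda>j. ?A j n) m = edge_count a b (\<lambda>j. rot (P j)) m" for a b
    by (rule edge_count_cong) (simp add: rot P_def)
  have v2: "edge_count a b (?B (2 * n)) m = edge_count a b (\<lambda>j. mirror (rot (P j))) m" for a b
  proof -
    have "edge_count a b (?B (2 * n)) m = edge_count a b (\<lambda>j. mirror (rot (P (m - j)))) m"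
      by (rule edge_count_cong) (simp add: mirror rot P_def)
    then show ?thesis using edge_count_rev [of a b "\<lambda>j. mirror (rot (P j))" m] by simp
  qed
  have v3: "edge_count a b (?B 0) m = edge_count a b P m"
      "edge_count a b (\<lambda>j. ?A j 0) m = edge_count a b P m" for a b
    by (simp_all add: P_def [abs_def])
  \<comment> \<open>The other edges are images of the path \<open>bot 0, \<dots>, bot n\<close>.\<close>
  have bot_rot: "bot (n + u) = rot (bot u)" if "u \<le> 2 * n" for u
    using that bot [of u n] bot [of u 0] rot [of u 0] by (simp add: add.commute)
  have top_bot: "top (2 * n + u) = mirror (bot u)" if "u \<le> n" for u
    using that top [of "2 * n" "n - u"] bot [of 0 u] mirror [of m "n - u"]
    by (simp add: mult_2 add.assoc)
  have top_rot: "top u = rot (top (n + u))" if "u \<le> 2 * n" for u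
    using that top [of u n] top [of u 0] rot [of u m] by (simp add: add.commute)
  have h1: "edge_count a b (?A 0) n = edge_count a b bot n" for a b
    by (rule edge_count_cong) (simp add: bot)
  have h2: "edge_count a b (?A m) n = edge_count a b (\<lambda>u. rot (rot (mirror (bot u)))) n" for a b
  proof -
    have "edge_count a b (?A m) n = edge_count a b (\<lambda>k. rot (rot (mirror (bot (n - k))))) n"
    proof (rule edge_count_cong)
      fix k assume "k \<le> n"
      then show "?A m k = rot (rot (mirror (bot (n - k))))"
        using top [of 0 k] top_rot [of "n - k"] top_rot [of "n + (n - k)"] top_bot [of "n - k"]
        by (simp add: mult_2 add.assoc)
    qed
    then show ?thesis using edge_count_rev [of a b "\<lambda>u. rot (rot (mirror (bot u)))" n] by simp
  qed
  have h3: "edge_count a b (\<lambda>i. ?B i 0) (2 * n) = edge_count a b bot n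
      + edge_count a b (\<lambda>u. rot (bot u)) n" for a b
  proof -
    have "edge_count a b (\<lambda>i. ?B i 0) (2 * n) = edge_count a b bot (n + n)"
      unfolding mult_2 by (rule edge_count_cong) (simp add: bot)
    also have "\<dots> = edge_count a b bot n + edge_count a b (\<lambda>i. bot (n + i)) n" by (rule edge_count_add)
    also have "edge_count a b (\<lambda>i. bot (n + i)) n = edge_count a b (\<lambda>u. rot (bot u)) n"
      by (rule edge_count_cong) (simp add: bot_rot)
    finally show ?thesis .
  qed
  have h4: "edge_count a b (\<lambda>i. ?B i m) (2 * n)
    = edge_count a b (\<lambda>u. rot (mirror (bot u))) n + edge_count a b (\<lambda>u. mirror (bot u)) n" for a b
  proof -
    have "edge_count a b (\<lambda>i. ?B i m) (2 * n) = edge_count a b (\<lambda>i. top (n + i)) (n + n)"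
      unfolding mult_2 by (rule edge_count_cong) (simp add: top add.commute)
    also have "\<dots> = edge_count a b (\<lambda>i. top (n + i)) n + edge_count a b (\<lambda>i. top (n + (n + i))) n"
      by (rule edge_count_add)
    also have "edge_count a b (\<lambda>i. top (n + i)) n = edge_count a b (\<lambda>u. rot (mirror (bot u))) n"
    proof (rule edge_count_cong)
      fix i assume "i \<le> n"
      then show "top (n + i) = rot (mirror (bot i))"
        using top_rot [of "n + i"] top_bot [of i] by (simp add: mult_2 add.assoc)
    qed
    also have "edge_count a b (\<lambda>i. top (n + (n + i))) n = edge_count a b (\<lambda>u. mirror (bot u)) n"
      by (rule edge_count_cong) (use top_bot in \<open>simp add: mult_2 add.assoc\<close>)
    finally show ?thesis .
  qed
  note R = edge_count_map [OF inj_rot] and G = edge_count_map [OF inj_mirror]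
  have "0 = edge_count P2 P3 bot n + edge_count N2 P3 bot n + (edge_count N1 P2 bot n
      + edge_count P1 P2 bot n)
     + (edge_count N1 N3 bot n + edge_count P1 N3 bot n) + (edge_count N1 N2 bot n
         + edge_count P1 N2 bot n)"
  proof -
    have p: "edge_count P2 P3 (\<lambda>j. rot (g j)) l = edge_count N1 N3 g l"
      "edge_count N1 P2 (\<lambda>j. rot (g j)) l = edge_count N2 N1 g l"
      "edge_count N1 N3 (\<lambda>j. rot (g j)) l = edge_count N2 P3 g l"
      "edge_count P2 P3 (\<lambda>j. mirror (g j)) l = edge_count P2 P3 g l"
      "edge_count N1 P2 (\<lambda>j. mirror (g j)) l = edge_count P1 P2 g l"
      "edge_count N1 N3 (\<lambda>j. mirror (g j)) l = edge_count P1 N3 g l"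
      "edge_count N2 N1 (\<lambda>j. mirror (g j)) l = edge_count N2 P1 g l"
      "edge_count N2 P3 (\<lambda>j. mirror (g j)) l = edge_count N2 P3 g l"
      "edge_count P1 P2 (\<lambda>j. rot (g j)) l = edge_count P2 N1 g l"
      for g l
      using R [of N1 N3] R [of N2 N1] R [of N2 P3] G [of P2 P3] G [of P1 P2] G [of P1 N3] G [of N2 P1] G [of N2 P3]
        R [of P2 N1]
      by simp_all
    have c: "edge_count N2 N1 g l = edge_count N1 N2 g l" "edge_count N2 P1 g l = edge_count P1 N2 g l"
        "edge_count P2 N1 g l = edge_count N1 P2 g l" for g l
      by (rule edge_count_swap)+
    show ?thesis
      using total unfolding v1 v2 v3 h1 h2 h3 h4 p c
      by (simp only: ac_simps add_self add_self_left add.right_neutral add.left_neutral)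
  qed
  also have "\<dots> = (\<Sum>i<n. of_bool (bot i \<in> {P2,N2,N3}) + of_bool (bot (Suc i) \<in> {P2,N2,N3}))"
    unfolding edge_count_def sum.distrib [symmetric]
  proof (intro sum.cong refl link_edges_sum)
    fix i assume "i \<in> {..<n}"
    then show "no_antipodes {bot i, bot (Suc i)}"
      using bot [of i 0] bot [of "Suc i" 0] \<open>0 < m\<close>
      by (intro no_antipodes_mono [OF no_antipodes [of i 0 0]]) auto
  qed
  also have "\<dots> = of_bool (bot 0 \<in> {P2,N2,N3}) + of_bool (bot n \<in> {P2,N2,N3})"
    by (rule sum_telescope_bit [of "\<lambda>i. of_bool (bot i \<in> {P2,N2,N3})"])
  also have "\<dots> = 1"
    using bot_rot [of 0] by (cases "bot 0") simp_all
  finally show False by simp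
qed

section \<open>Equivariant maps on the space of frames have zeros\<close>

fun signed_coord :: "oct_vertex \<Rightarrow> real \<times> real \<times> real \<Rightarrow> real" where
  "signed_coord P1 (x, y, z) = x" | "signed_coord N1 (x, y, z) = - x"
| "signed_coord P2 (x, y, z) = y" | "signed_coord N2 (x, y, z) = - y"
| "signed_coord P3 (x, y, z) = z" | "signed_coord N3 (x, y, z) = - z"

fun rotv :: "real \<times> real \<times> real \<Rightarrow> real \<times> real \<times> real" where
  "rotv (x, y, z) = (y, - x, - z)"

fun mirrorv :: "real \<times> real \<times> real \<Rightarrow> real \<times> real \<times> real" where
  "mirrorv (x, y, z) = (- x, y, z)"

lemma signed_coord_rot: "signed_coord (rot l) (rotv v) = signed_coord l v"
  by (cases v; cases l) simp_all

lemma signed_coord_mirror: "signed_coord (mirror l) (mirrorv v) = signed_coord l v"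
  by (cases v; cases l) simp_all

lemma signed_coord_antipode: "signed_coord (antipode l) v = - signed_coord l v"
  by (cases v; cases l) simp_all

lemma signed_coord_diff_le: "\<bar>signed_coord l v - signed_coord l v'\<bar> \<le> dist v v'"
proof -
  obtain x y z x' y' z' where v: "v = (x, y, z)" "v' = (x', y', z')"
    by (metis prod.exhaust)
  have "dist x x' \<le> dist v v'" "dist y y' \<le> dist v v'" "dist z z' \<le> dist v v'"
    using dist_fst_le [of v v'] dist_snd_le [of v v'] dist_fst_le [of "snd v" "snd v'"]
      dist_snd_le [of "snd v" "snd v'"] unfolding v by auto
  then show ?thesis
    unfolding v by (cases l) (auto simp: dist_real_def)
qed

lemma exists_large_signed_coord:
  assumes "v \<noteq> 0"
  shows "\<exists>l. norm v / 3 \<le> signed_coord l v"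
proof -
  obtain x y z where v: "v = (x, y, z)" by (metis prod.exhaust)
  have "norm v \<le> \<bar>x\<bar> + (\<bar>y\<bar> + \<bar>z\<bar>)"
    using norm_Pair_le [of x "(y, z)"] norm_Pair_le [of y z] unfolding v by simp
  then have "norm v / 3 \<le> \<bar>x\<bar> \<or> norm v / 3 \<le> \<bar>y\<bar> \<or> norm v / 3 \<le> \<bar>z\<bar>"
    by linarith
  then have "norm v / 3 \<le> signed_coord P1 v \<or> norm v / 3 \<le> signed_coord N1 v \<or> norm v / 3 \<le> signed_coord P2 v
    \<or> norm v / 3 \<le> signed_coord N2 v \<or> norm v / 3 \<le> signed_coord P3 v \<or> norm v / 3 \<le> signed_coord N3 v"
    unfolding v by (auto simp: abs_real_def split: if_splits)
  then show ?thesis by blast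
qed

text \<open>
A zero-free \<open>G\<close> would produce a labelling of the kind excluded by \<open>no_equivariant_labelling\<close>: label
each grid point by a signed axis along which \<open>G\<close> is at least \<open>d\<close>.  The only difficulty is that such a label is
not unique, and no rule that looks at the value of \<open>G\<close> alone respects the symmetries: a value such as
\<open>(1, 1, 0)\<close> is fixed by a symmetry that fixes none of its two largest axes.  The labels are therefore
chosen on one grid point from each class of identified points and transported to the others.
\<close>

lemma equivariant_map_has_zero:
  fixes G :: "real \<Rightarrow> real \<Rightarrow> real \<Rightarrow> real \<times> real \<times> real"
  assumes cont: "continuous_on UNIV (\<lambda>(a, t, b). G a t b)"
    and rot: "\<And>a t b. G a t (b + pi / 2) = rotv (G a t b)"
    and refl: "\<And>t b. G pi t b = mirrorv (G 0 (pi - t) (pi / 2 - b))"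
    and bot: "\<And>a b. G a 0 b = G 0 0 (a + b)"
    and top: "\<And>a b. G a pi b = mirrorv (rotv (rotv (G 0 0 (a - b + pi / 2))))"
  shows "\<exists>a t b. G a t b = 0"
proof (rule ccontr)
  assume "\<not> ?thesis"
  then have nz: "G a t b \<noteq> 0" for a t b by blast
  define C where "C = {0..pi} \<times> {0..pi} \<times> {0..pi/2}"
  have "compact C" unfolding C_def by (intro compact_Times compact_Icc)
  have contC: "continuous_on C (\<lambda>(a, t, b). G a t b)"
    using cont by (rule continuous_on_subset) simp
  have "C \<noteq> {}" unfolding C_def by auto
  have "continuous_on C (\<lambda>p. norm (case p of (a, t, b) \<Rightarrow> G a t b))"
    by (intro continuous_on_norm contC)
  from continuous_attains_inf [OF \<open>compact C\<close> \<open>C \<noteq> {}\<close> this] obtain p0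
    where p0: "p0 \<in> C" "\<And>p. p \<in> C
        \<Longrightarrow> norm (case p0 of (a, t, b) \<Rightarrow> G a t b) \<le> norm (case p of (a, t, b) \<Rightarrow> G a t b)"
    by blast
  define d where "d = norm (case p0 of (a, t, b) \<Rightarrow> G a t b) / 3"
  have "d > 0" unfolding d_def using nz by (auto split: prod.split)
  have large: "\<exists>l. d \<le> signed_coord l (G a t b)" if "(a, t, b) \<in> C" for a t b
    using exists_large_signed_coord [OF nz [of a t b]] p0(2) [OF that] unfolding d_def
    by (metis (no_types, lifting) case_prod_conv divide_right_mono order_trans zero_le_numeral)
  from compact_uniformly_continuous [OF contC \<open>compact C\<close>] \<open>d > 0\<close> obtain e
    where "e > 0" and e: "\<And>p p'. p \<in> C \<Longrightarrow> p' \<in> C \<Longrightarrow> dist p' p < e \<Longrightarrow>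
      dist (case p' of (a, t, b) \<Rightarrow> G a t b) (case p of (a, t, b) \<Rightarrow> G a t b) < d"
    unfolding uniformly_continuous_on_def by metis
  obtain n :: nat where n: "3 * pi / e < real n" using reals_Archimedean2 by blast
  have "n > 0"
    using n \<open>e > 0\<close> pi_gt_zero by (cases n) (auto simp: field_simps)
  define h where "h = pi / (2 * real n)"
  have "h > 0" unfolding h_def using \<open>n > 0\<close> by simp
  have "3 * pi < e * real n" using n \<open>e > 0\<close> by (simp add: field_simps)
  moreover have "0 < e * real n" using \<open>n > 0\<close> \<open>e > 0\<close> by simp
  ultimately have "3 * pi < e * (2 * real n)" by linarith
  then have h3: "3 * h < e"
    unfolding h_def using \<open>n > 0\<close> by (simp add: field_simps)
  have hn: "real n * h = pi / 2" "real (2 * n) * h = pi"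
    unfolding h_def using \<open>n > 0\<close> by simp_all
  define pt where "pt i j k = G (real i * h) (real j * h) (real k * h)" for i j k :: nat
  have inC: "(real i * h, real j * h, real k * h) \<in> C" if "i \<le> 2 * n" "j \<le> 2 * n" "k \<le> n" for i j k
  proof -
    have "real i * h \<le> real (2 * n) * h" "real j * h \<le> real (2 * n) * h" "real k * h \<le> real n * h"
      using that \<open>h > 0\<close> by simp_all
    then show ?thesis unfolding C_def hn using \<open>h > 0\<close> by simp
  qed
  define ok where "ok l v \<longleftrightarrow> d \<le> signed_coord l v" for l v
  have "\<exists>l. ok l (pt i j k)" if "i \<le> 2 * n" "j \<le> 2 * n" "k \<le> n" for i j k
    unfolding ok_def pt_def by (rule large [OF inC [OF that]])
  then obtain l where l: "\<And>i j k. i \<le> 2 * n \<Longrightarrow> j \<le> 2 * n \<Longrightarrow> k \<le> n \<Longrightarrow> ok (l i j k) (pt i j k)"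
    by metis
  have ok_rot: "ok (rot x) (rotv v) \<longleftrightarrow> ok x v" for x v by (simp add: ok_def signed_coord_rot)
  have ok_refl: "ok (mirror x) (mirrorv v) \<longleftrightarrow> ok x v" for x v by (simp add: ok_def signed_coord_mirror)
  have pt_rot: "pt i j (k + n) = rotv (pt i j k)" for i j k
    using rot [of "real i * h" "real j * h" "real k * h"] by (simp only: pt_def of_nat_add distrib_right hn)
  have pt_refl: "pt (2 * n) j k = mirrorv (pt 0 (2 * n - j) (n - k))" if "j \<le> 2 * n" "k \<le> n" for j k
    using refl [of "real j * h" "real k * h"] that
    by (simp only: pt_def of_nat_diff left_diff_distrib hn of_nat_0 mult_zero_left)
  have pt_bot: "pt i 0 k = pt 0 0 (i + k)" for i k
    using bot [of "real i * h" "real k * h"] by (simp add: pt_def distrib_right)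
  have pt_top: "pt i (2 * n) k = mirrorv (rotv (rotv (pt 0 0 (i + n - k))))" if "k \<le> n" for i k
  proof -
    have "real (i + n - k) * h = real i * h - real k * h + pi / 2"
      using that hn(1) by (simp only: of_nat_diff of_nat_add trans_le_add2 left_diff_distrib distrib_right)
    with top [of "real i * h" "real k * h"] show ?thesis
      by (simp only: pt_def hn of_nat_0 mult_zero_left)
  qed
  \<comment> \<open>The labels on the circle to which the face \<open>t = 0\<close> collapses are chosen on a quarter of it.\<close>
  define bt where "bt s = (rot ^^ (s div n)) (l 0 0 (s mod n))" for s
  \<comment> \<open>The symmetry that takes the circle of the face \<open>t = 0\<close> to that of the face \<open>t = \<pi>\<close> determines the labels
    there; the argument \<open>s\<close> corresponds to \<open>a - b + \<pi>/2\<close>, which is not negative on the cube.\<close>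
  define tp where "tp s = mirror (rot (rot (bt s)))" for s
  have bt_rot: "bt (s + n) = rot (bt s)" for s
    unfolding bt_def using \<open>n > 0\<close> by simp
  have "ok ((rot ^^ q) (l 0 0 r)) (pt 0 0 (r + q * n))" if "r < n" for q r
  proof (induction q)
    case 0
    show ?case using l that by simp
  next
    case (Suc q)
    have "pt 0 0 (r + Suc q * n) = rotv (pt 0 0 (r + q * n))"
      using pt_rot [of 0 0 "r + q * n"] by (simp add: ac_simps)
    then show ?case using Suc by (simp add: ok_rot)
  qed
  from this [of "s mod n" "s div n" for s] have ok_bt: "ok (bt s) (pt 0 0 s)" for s
    unfolding bt_def using \<open>n > 0\<close> by simp
  \<comment> \<open>The labels \<open>E\<close> of the face \<open>a = 0\<close> also determine those of the face \<open>a = \<pi>\<close>.\<close>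
  define E where "E j k = (if k = n then rot (l 0 j 0) else l 0 j k)" for j k
  have ok_E: "ok (E j k) (pt 0 j k)" if "j \<le> 2 * n" "k \<le> n" for j k
    using l [of 0 j k] l [of 0 j 0] that pt_rot [of 0 j 0] by (auto simp: E_def ok_rot)
  define L where "L i j k = (if j = 0 then bt (i + k) else if j = 2 * n then tp (i + n - k)
    else if i = 2 * n then mirror (E (2 * n - j) (n - k))
    else if k = n then rot (l i j 0) else l i j k)" for i j k
  have ok_L: "ok (L i j k) (pt i j k)" if "i \<le> 2 * n" "j \<le> 2 * n" "k \<le> n" for i j k
  proof -
    consider "j = 0" | "j = 2 * n" | "j \<noteq> 0" "j \<noteq> 2 * n" "i = 2 * n"
      | "j \<noteq> 0" "j \<noteq> 2 * n" "i \<noteq> 2 * n" "k = n" | "j \<noteq> 0" "j \<noteq> 2 * n" "i \<noteq> 2 * n" "k \<noteq> n"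
      by blast
    then show ?thesis
    proof cases
      case 1
      then show ?thesis using ok_bt [of "i + k"] pt_bot [of i k] by (simp add: L_def)
    next
      case 2
      then show ?thesis using ok_bt [of
          "i + n - k"] pt_top [of k i] that \<open>n > 0\<close> by (simp add: L_def tp_def ok_refl ok_rot)
    next
      case 3
      then show ?thesis using ok_E [of "2 * n - j" "n - k"] pt_refl that by (simp add: L_def ok_refl)
    next
      case 4
      then show ?thesis using l [of i j 0] pt_rot [of i j 0] that by (simp add: L_def ok_rot)
    next
      case 5
      then show ?thesis using l that by (simp add: L_def)
    qed
  qed
  have rr: "rot (rot (rot (rot x))) = x" "mirror (mirror x) = x"
    "rot (mirror (rot x)) = mirror x" for x
    by (cases x; simp)+
  show False
  proof (rule no_equivariant_labelling [of n "2 * n" L bt tp])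
    show "0 < n" "0 < 2 * n" using \<open>n > 0\<close> by simp_all
    show "L i 0 k = bt (i + k)" for i k by (simp add: L_def)
    show "L i (2 * n) k = tp (i + n - k)" for i k using \<open>n > 0\<close> by (simp add: L_def)
    show "L i j n = rot (L i j 0)" for i j
      using \<open>n > 0\<close> bt_rot [of i] by (auto simp: L_def tp_def E_def rr)
    show "L (2 * n) j k = mirror (L 0 (2 * n - j) (n - k))" if "j \<le> 2 * n" "k \<le> n" for j k
    proof -
      consider "j = 0" | "j = 2 * n" | "0 < j" "j < 2 * n" using \<open>j \<le> 2 * n\<close> by linarith
      then show ?thesis
      proof cases
        case 1
        have "2 * n + k = k + n + n" by simp
        then have "bt (2 * n + k) = rot (rot (bt k))"
          by (simp only: bt_rot)
        with 1 show ?thesis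
          using \<open>n > 0\<close> \<open>k \<le> n\<close> by (simp add: L_def tp_def rr)
      next
        case 2
        have "2 * n + n - k = n - k + n + n" using \<open>k \<le> n\<close> by simp
        then have "tp (2 * n + n - k) = mirror (rot (rot (rot (rot (bt (n - k))))))"
          by (simp only: tp_def bt_rot)
        with 2 show ?thesis using \<open>n > 0\<close> by (simp add: L_def rr)
      next
        case 3
        then show ?thesis using \<open>n > 0\<close> by (auto simp: L_def E_def)
      qed
    qed
    show "no_antipodes ((\<lambda>(i, j, k). L i j k) ` ({i, Suc i} \<times> {j, Suc j} \<times> {k, Suc k}))"
      if "i < 2 * n" "j < 2 * n" "k < n" for i j k
    proof -
      have "antipode (L i1 j1 k1) \<noteq> L i2 j2 k2"
        if *: "i1 \<in> {i, Suc i}" "j1 \<in> {j, Suc j}" "k1 \<in> {k, Suc k}"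
          "i2 \<in> {i, Suc i}" "j2 \<in> {j, Suc j}" "k2 \<in> {k, Suc k}" for i1 j1 k1 i2 j2 k2
      proof
        assume o: "antipode (L i1 j1 k1) = L i2 j2 k2"
        have r: "i1 \<le> 2 * n" "j1 \<le> 2 * n" "k1 \<le> n" "i2 \<le> 2 * n" "j2 \<le> 2 * n" "k2 \<le> n"
          using * \<open>i < 2 * n\<close> \<open>j < 2 * n\<close> \<open>k < n\<close> by auto
        have step: "dist (real x1 * h) (real x2 * h) \<le> h" if "x1 \<in> {x, Suc x}" "x2 \<in> {x, Suc x}" for x x1 x2
          using that \<open>h > 0\<close> by (auto simp: dist_real_def algebra_simps)
        have Pair: "dist (x, y) (x', y') \<le> dist x x' + dist y y'"
          for x x' :: real and y y' :: "'b::metric_space"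
          by (simp add: dist_Pair_Pair sqrt_sum_squares_le_sum)
        have "dist (real i1 * h, real j1 * h, real k1 * h) (real i2 * h, real j2 * h, real k2 * h)
          \<le> dist (real i1 * h) (real i2 * h)
              + (dist (real j1 * h) (real j2 * h) + dist (real k1 * h) (real k2 * h))"
          using Pair [of "real i1 * h" "(real j1 * h, real k1 * h)"
              "real i2 * h" "(real j2 * h, real k2 * h)"]
            Pair [of "real j1 * h" "real k1 * h" "real j2 * h" "real k2 * h"] by linarith
        also have "\<dots> < e"
          using step [OF *(1,4)] step [OF *(2,5)] step [OF *(3,6)] h3 by linarith
        finally have "dist (pt i1 j1 k1) (pt i2 j2 k2) < d"
          using e [OF inC [OF r(4-6)] inC [OF r(1-3)]] by (simp add: pt_def)
        moreover have "d \<le> signed_coord (L i1 j1 k1) (pt i1 j1 k1)"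
            "d \<le> - signed_coord (L i1 j1 k1) (pt i2 j2 k2)"
          using ok_L [OF r(1-3)] ok_L [OF r(4-6)] unfolding o [symmetric] ok_def signed_coord_antipode by auto
        ultimately show False
          using signed_coord_diff_le [of "L i1 j1 k1" "pt i1 j1 k1" "pt i2 j2 k2"] \<open>d > 0\<close> by linarith
      qed
      then show ?thesis
        by (intro no_antipodes_imageI) (simp only: split_def mem_Times_iff not_False_eq_True)
    qed
  qed
qed

section \<open>Orthonormal frames in Euler angles\<close>

definition ex where "ex = (axis 1 1 :: real ^ 3)"
definition ey where "ey = (axis 2 1 :: real ^ 3)"
definition ez where "ez = (axis 3 1 :: real ^ 3)"

lemma std_orthonormal:
  "inner ex ex = 1" "inner ey ey = 1" "inner ez ez = 1" "inner ex ey = 0" "inner ex ez = 0"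
      "inner ey ez = 0"
  "inner ey ex = 0" "inner ez ex = 0" "inner ez ey = 0"
  by (simp_all add: ex_def ey_def ez_def inner_axis_axis)

text \<open>
The columns \<open>frame_u\<close>, \<open>frame_v\<close>, \<open>frame_w\<close> of the rotation with Euler angles \<open>(a, t, b)\<close>, that is,
of the product of the rotations by \<open>a\<close> about \<open>ez\<close>, by \<open>t\<close> about \<open>ex\<close> and by \<open>b\<close> about
\<open>ez\<close>; \<open>frame_y\<close> is the second column of the product of the first two.
\<close>

definition frame_y where "frame_y a t = cos t *\<^sub>R (cos a *\<^sub>R ey - sin a *\<^sub>R ex) + sin t *\<^sub>R ez"
definition frame_u where "frame_u a t b = cos b *\<^sub>R (cos a *\<^sub>R ex + sin a *\<^sub>R ey) + sin b *\<^sub>R frame_y a t"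
definition frame_v where "frame_v a t b = cos b *\<^sub>R frame_y a t - sin b *\<^sub>R (cos a *\<^sub>R ex + sin a *\<^sub>R ey)"
definition frame_w where "frame_w a t = cos t *\<^sub>R ez - sin t *\<^sub>R (cos a *\<^sub>R ey - sin a *\<^sub>R ex)"

lemma frame_orthonormal:
  "inner (frame_u a t b) (frame_u a t b) = 1" "inner (frame_v a t b) (frame_v a t b) = 1"
      "inner (frame_w a t) (frame_w a t) = 1"
  "inner (frame_u a t b) (frame_v a t b) = 0" "inner (frame_u a t b) (frame_w a t) = 0"
      "inner (frame_v a t b) (frame_w a t) = 0"
proof -
  define x where "x = cos a *\<^sub>R ex + sin a *\<^sub>R ey"
  define x' where "x' = cos a *\<^sub>R ey - sin a *\<^sub>R ex"
  have sq: "cos r * cos r + sin r * sin r = 1" "sin r * sin r + cos r * cos r = 1" for r :: real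
    using sin_cos_squared_add3 [of r] by (simp_all add: add.commute)
  have x: "inner x x = 1" "inner x' x' = 1" "inner x x' = 0" "inner x' x = 0"
    "inner x ez = 0" "inner x' ez = 0" "inner ez x = 0" "inner ez x' = 0"
    unfolding x_def x'_def by (simp_all add: inner_simps std_orthonormal sq)
  have y: "inner (frame_y a t) (frame_y a t) = 1" "inner x (frame_y a t) = 0" "inner (frame_y a t) x = 0"
    "inner (frame_w a t) (frame_w a t) = 1" "inner x (frame_w a t) = 0"
        "inner (frame_y a t) (frame_w a t) = 0"
    unfolding frame_y_def frame_w_def x'_def [symmetric] by (simp_all add: inner_simps std_orthonormal x sq)
  show "inner (frame_u a t b) (frame_u a t b) = 1" "inner (frame_v a t b) (frame_v a t b) = 1"
      "inner (frame_w a t) (frame_w a t) = 1"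
    "inner (frame_u a t b) (frame_v a t b) = 0" "inner (frame_u a t b) (frame_w a t) = 0"
        "inner (frame_v a t b) (frame_w a t) = 0"
    unfolding frame_u_def frame_v_def x_def [symmetric] by (simp_all add: inner_simps x y sq)
qed

lemma frame_quarter_turn: "frame_u a t (b + pi / 2) = frame_v a t b"
    "frame_v a t (b + pi / 2) = - frame_u a t b"
  by (simp_all add: frame_u_def frame_v_def sin_add cos_add)

lemma frame_flip:
  "frame_u pi t b = frame_v 0 (pi - t) (pi / 2 - b)" "frame_v pi t b = frame_u 0 (pi - t) (pi / 2 - b)"
      "frame_w pi t = - frame_w 0 (pi - t)"
  by (simp_all add: frame_u_def frame_v_def frame_w_def frame_y_def sin_diff cos_diff algebra_simps)

lemma frame_pole:
  "frame_u a 0 b = frame_u 0 0 (a + b)" "frame_v a 0 b = frame_v 0 0 (a + b)" "frame_w a 0 = frame_w 0 0"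
  by (simp_all add: frame_u_def frame_v_def frame_w_def frame_y_def sin_add cos_add algebra_simps)

lemma frame_antipole:
  "frame_u a pi b = - frame_v 0 0 (a - b + pi / 2)" "frame_v a pi b = - frame_u 0 0 (a - b + pi / 2)"
      "frame_w a pi = - frame_w 0 0"
  by (simp_all add: frame_u_def frame_v_def frame_w_def frame_y_def sin_add cos_add sin_diff cos_diff algebra_simps)

lemma continuous_frame:
  "continuous_on UNIV (\<lambda>(a, t, b). x *\<^sub>R frame_u a t b + y *\<^sub>R frame_v a t b + q *\<^sub>R frame_w a t)"
  unfolding frame_u_def frame_v_def frame_w_def frame_y_def split_def
  by (intro continuous_intros)

text \<open>
The identities between Euler frames turn into exactly the symmetries of \<open>G\<close> required by
\<open>equivariant_map_has_zero\<close>.  Evenness enters because the frames at the ends of the \<open>t\<close> and \<open>a\<close>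
ranges agree up to a change of sign of \<open>w\<close>: the corners of the square are then
permuted only up to sign.
\<close>

lemma even_function_equal_on_square:
  fixes f :: "real ^ 3 \<Rightarrow> real"
  assumes cont: "continuous_on UNIV f" and even: "\<And>x. f (- x) = f x"
  obtains u v w where "norm u = 1" "norm v = 1" "norm w = 1"
    "orthogonal u v" "orthogonal u w" "orthogonal v w"
    "f (- u + v + q *\<^sub>R w) = f (u + v + q *\<^sub>R w)" "f (- u - v + q *\<^sub>R w) = f (u + v + q *\<^sub>R w)"
    "f (u - v + q *\<^sub>R w) = f (u + v + q *\<^sub>R w)"
proof -
  \<comment> \<open>\<open>g x y\<close> with \<open>x\<close>, \<open>y\<close> in \<open>{-1, 1}\<close> are the values at the four corners.\<close>
  define g where "g x y a t b
      = f (x *\<^sub>R frame_u a t b + y *\<^sub>R frame_v a t b + q *\<^sub>R frame_w a t)" for x y a t b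
  define G where "G a t b = (g 1 1 a t b - g (-1) (-1) a t b, g (-1) 1 a t b - g 1 (-1) a t b,
    g 1 1 a t b - g (-1) 1 a t b + g (-1) (-1) a t b - g 1 (-1) a t b)" for a t b
  have contg: "continuous_on UNIV (\<lambda>p. g x y (fst p) (fst (snd p)) (snd (snd p)))" for x y
    unfolding g_def
    using continuous_on_compose2 [OF cont continuous_frame [of x y q, unfolded split_def]] by simp
  have f_cong: "f X = f Y" if "X = Y \<or> X = - Y" for X Y
    using that even by auto
  have g_turn: "g x y a t (b + pi / 2) = g (- y) x a t b" for x y a t b
    unfolding g_def by (rule f_cong) (simp add: frame_quarter_turn algebra_simps)
  have g_flip: "g x y pi t b = g (- y) (- x) 0 (pi - t) (pi / 2 - b)" for x y t b
    unfolding g_def by (rule f_cong) (simp add: frame_flip algebra_simps)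
  have g_pole: "g x y a 0 b = g x y 0 0 (a + b)" for x y a b
    unfolding g_def frame_pole(1,2) [of a b] frame_pole(3) [of a] ..
  have g_antipole: "g x y a pi b = g y x 0 0 (a - b + pi / 2)" for x y a b
    unfolding g_def by (rule f_cong) (simp add: frame_antipole algebra_simps)
  have "\<exists>a t b. G a t b = 0"
  proof (rule equivariant_map_has_zero)
    show "continuous_on UNIV (\<lambda>(a, t, b). G a t b)"
      unfolding G_def split_def by (intro continuous_on_Pair continuous_on_diff continuous_on_add contg)
    show "G a t (b + pi / 2) = rotv (G a t b)" for a t b
      by (simp add: G_def g_turn)
    show "G pi t b = mirrorv (G 0 (pi - t) (pi / 2 - b))" for t b
      by (simp add: G_def g_flip)
    show "G a 0 b = G 0 0 (a + b)" for a b
      by (simp add: G_def g_pole [of _ _ a b])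
    show "G a pi b = mirrorv (rotv (rotv (G 0 0 (a - b + pi / 2))))" for a b
      by (simp add: G_def g_antipole)
  qed
  then obtain a t b where "G a t b = 0" by blast
  then have eq: "g (-1) (-1) a t b = g 1 1 a t b" "g (-1) 1 a t b = g 1 1 a t b"
      "g 1 (-1) a t b = g 1 1 a t b"
    by (simp_all add: G_def zero_prod_def)
  show ?thesis
    by (rule that [of "frame_u a t b" "frame_v a t b" "frame_w a t"])
      (use eq in \<open>simp_all add: g_def norm_eq_1 orthogonal_def frame_orthonormal\<close>)
qed

section \<open>The norm defined by a symmetric convex body\<close>

definition minkowski_gauge :: "'a::real_normed_vector set \<Rightarrow> 'a \<Rightarrow> real" where
  "minkowski_gauge S x = Inf {r. 0 < r \<and> x /\<^sub>R r \<in> S}"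

text \<open>
The radius \<open>\<rho>\<close> of a ball inside \<open>S\<close> is a parameter because the Lipschitz constant of the gauge
is \<open>1 / \<rho>\<close>.
\<close>

locale gauge_body =
  fixes S :: "'a::real_normed_vector set" and \<rho> :: real
  assumes convex: "convex S" and closed: "closed S" and bounded: "bounded S"
    and \<rho>: "0 < \<rho>" "cball 0 \<rho> \<subseteq> S"
begin

lemma zero_in: "0 \<in> S"
  using \<rho> by auto

lemma in_scaled: "0 < r \<Longrightarrow> norm x / \<rho> \<le> r \<Longrightarrow> x /\<^sub>R r \<in> S"
  using \<rho> by (auto simp: field_simps intro!: subsetD [OF \<rho>(2)])

lemma gauge_le: "0 < r \<Longrightarrow> x /\<^sub>R r \<in> S \<Longrightarrow> minkowski_gauge S x \<le> r"
  unfolding minkowski_gauge_def by (rule cInf_lower) (auto intro!: bdd_belowI [of _ 0])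

lemma gauge_set_nonempty: "{r. 0 < r \<and> x /\<^sub>R r \<in> S} \<noteq> {}"
proof -
  have "0 < norm x / \<rho> + 1" using \<rho>(1) by (simp add: add_nonneg_pos)
  then show ?thesis using in_scaled [of "norm x / \<rho> + 1" x] by auto
qed

lemma gauge_nonneg: "0 \<le> minkowski_gauge S x"
  unfolding minkowski_gauge_def by (rule cInf_greatest [OF gauge_set_nonempty]) auto

lemma in_if_gauge_less:
  assumes "minkowski_gauge S x < r"
  shows "x /\<^sub>R r \<in> S"
proof -
  obtain s where s: "0 < s" "x /\<^sub>R s \<in> S" "s < r"
    using cInf_lessD [OF gauge_set_nonempty assms [unfolded minkowski_gauge_def]] by auto
  have "(s / r) *\<^sub>R (x /\<^sub>R s) + (1 - s / r) *\<^sub>R 0 \<in> S"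
    by (rule convexD [OF convex s(2) zero_in]) (use s in auto)
  then show ?thesis using s by (simp add: field_simps)
qed

lemma gauge_le_norm: "minkowski_gauge S x \<le> norm x / \<rho>"
proof (rule field_le_epsilon)
  fix e :: real assume "0 < e"
  then have "0 < norm x / \<rho> + e" using \<rho>(1) by (simp add: add_nonneg_pos)
  then show "minkowski_gauge S x \<le> norm x / \<rho> + e"
    using \<open>0 < e\<close> by (intro gauge_le in_scaled) auto
qed

lemma gauge_triangle: "minkowski_gauge S (x + y) \<le> minkowski_gauge S x + minkowski_gauge S y"
proof (rule field_le_epsilon)
  fix e :: real assume "0 < e"
  define r s where "r = minkowski_gauge S x + e / 2" and "s = minkowski_gauge S y + e / 2"
  have pos: "0 < r" "0 < s"
    unfolding r_def s_def using \<open>0 < e\<close> gauge_nonneg by (simp_all add: add_nonneg_pos)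
  have "x /\<^sub>R r \<in> S" "y /\<^sub>R s \<in> S"
    using \<open>0 < e\<close> by (auto simp: r_def s_def intro!: in_if_gauge_less)
  then have "(r / (r + s)) *\<^sub>R (x /\<^sub>R r) + (s / (r + s)) *\<^sub>R (y /\<^sub>R s) \<in> S"
    by (rule convexD [OF convex]) (use pos in \<open>auto simp flip: add_divide_distrib\<close>)
  also have "(r / (r + s)) *\<^sub>R (x /\<^sub>R r) + (s / (r + s)) *\<^sub>R (y /\<^sub>R s) = (x + y) /\<^sub>R (r + s)"
    using pos by (simp add: field_simps scaleR_add_right)
  finally have "minkowski_gauge S (x + y) \<le> r + s"
    using pos by (intro gauge_le) auto
  then show "minkowski_gauge S (x + y) \<le> minkowski_gauge S x + minkowski_gauge S y + e" by (simp add: r_def s_def)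
qed

lemma continuous_gauge: "continuous_on UNIV (minkowski_gauge S)"
proof -
  have "minkowski_gauge S x - minkowski_gauge S y \<le> norm (x - y) / \<rho>" for x y
    using gauge_triangle [of "x - y" y] gauge_le_norm [of "x - y"] by simp
  then have "\<bar>minkowski_gauge S x - minkowski_gauge S y\<bar> \<le> norm (x - y) / \<rho>" for x y
    by (metis abs_le_iff minus_diff_eq norm_minus_commute)
  then have "(1 / \<rho>)-lipschitz_on UNIV (minkowski_gauge S)"
    using \<rho>(1) by (intro lipschitz_onI) (auto simp: dist_norm)
  then show ?thesis by (rule lipschitz_on_continuous_on)
qed

lemma gauge_pos:
  assumes "x \<noteq> 0"
  shows "0 < minkowski_gauge S x"
proof (rule ccontr)
  assume "\<not> 0 < minkowski_gauge S x"
  then have in_S: "x /\<^sub>R r \<in> S" if "0 < r" for r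
    using that by (intro in_if_gauge_less) simp
  obtain B where B: "0 < B" "\<And>y. y \<in> S \<Longrightarrow> norm y \<le> B"
    using bounded bounded_pos by blast
  have "norm (x /\<^sub>R (norm x / (2 * B))) \<le> B"
    using assms B(1) by (intro B(2) in_S) simp
  then show False using assms B(1) by simp
qed

text \<open>
The points \<open>x / r\<close> with \<open>r\<close> above the gauge lie in the closed set \<open>S\<close>, those with \<open>r\<close> below it
do not; at the gauge itself the ray leaves \<open>S\<close>.
\<close>

lemma scaled_in_frontier:
  assumes "x \<noteq> 0"
  shows "x /\<^sub>R minkowski_gauge S x \<in> frontier S"
proof -
  let ?g = "minkowski_gauge S x"
  have g: "0 < ?g" using gauge_pos [OF assms] .
  have lim: "((\<lambda>r. x /\<^sub>R r) \<longlongrightarrow> x /\<^sub>R ?g) (at ?g within T)" for T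
    using g by (intro tendsto_intros) auto
  have "x /\<^sub>R ?g \<in> S"
  proof (rule Lim_in_closed_set [OF closed])
    show "eventually (\<lambda>r. x /\<^sub>R r \<in> S) (at_right ?g)"
      using in_if_gauge_less by (auto simp: eventually_at_filter)
  qed (use lim in auto)
  moreover have "x /\<^sub>R ?g \<notin> interior S"
  proof
    assume "x /\<^sub>R ?g \<in> interior S"
    then have "eventually (\<lambda>r. x /\<^sub>R r \<in> interior S) (at_left ?g)"
      by (rule topological_tendstoD [OF lim open_interior])
    moreover have "eventually (\<lambda>r. 0 < r) (at_left ?g)"
      using eventually_at_left_field g by blast
    moreover have "eventually (\<lambda>r. r < ?g) (at_left ?g)"
      by (auto simp: eventually_at_filter)
    ultimately have "eventually (\<lambda>r. False) (at_left ?g)"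
    proof eventually_elim
      case (elim r)
      then show ?case using gauge_le [of r x] interior_subset [of S] by auto
    qed
    then show False by simp
  qed
  ultimately show ?thesis using closed by (simp add: frontier_def)
qed

lemma gauge_even:
  assumes "\<And>x. x \<in> S \<Longrightarrow> - x \<in> S"
  shows "minkowski_gauge S (- x) = minkowski_gauge S x"
proof -
  have "- x \<in> S \<longleftrightarrow> x \<in> S" for x
    using assms [of x] assms [of "- x"] by auto
  then show ?thesis by (simp add: minkowski_gauge_def)
qed

end

text \<open>
Symmetry and convexity put the midpoint of an interior point and its reflection, which is the centre, into
the interior.
\<close>

lemma symmetric_convex_body_gauge:
  fixes K :: "(real ^ 3) set"
  assumes "convex_body K" "symmetric_about c K"
  obtains \<rho> where "gauge_body ((+) (- c) ` K) \<rho>" "\<And>x. x \<in> (+) (- c) ` K \<Longrightarrow> - x \<in> (+) (- c) ` K"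
proof -
  let ?S = "(+) (- c) ` K"
  have K: "compact K" "convex K" "interior K \<noteq> {}"
    using assms(1) by (auto simp: convex_body_def)
  have sym: "- x \<in> ?S" if x: "x \<in> ?S" for x
  proof -
    obtain y where y: "y \<in> K" "x = - c + y" using x by blast
    have "2 *\<^sub>R c - y \<in> K" using assms(2) y(1) unfolding symmetric_about_def by blast
    moreover have "- x = - c + (2 *\<^sub>R c - y)" using y(2) by (simp add: scaleR_2)
    ultimately show ?thesis by blast
  qed
  then have "uminus ` ?S = ?S" by force
  then have "uminus ` interior ?S = interior ?S" by (metis interior_negations)
  moreover obtain y where "y \<in> interior ?S"
    using K(3) unfolding interior_translation by blast
  ultimately have y: "y \<in> interior ?S" "- y \<in> interior ?S" by blast+
  have convex: "convex ?S" using K(2) by (rule convex_translation)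
  have "(1/2) *\<^sub>R y + (1/2) *\<^sub>R (- y) \<in> interior ?S"
    by (rule convexD [OF convex_interior [OF convex] y]) simp_all
  then have "0 \<in> interior ?S" by simp
  then obtain \<rho> where \<rho>: "0 < \<rho>" "cball 0 \<rho> \<subseteq> ?S" by (auto simp: mem_interior_cball)
  have "compact ?S" using K(1) by (rule compact_translation)
  then have "gauge_body ?S \<rho>"
    using convex \<rho> by unfold_locales (simp_all add: compact_imp_closed compact_imp_bounded)
  then show ?thesis using sym that by blast
qed

section \<open>Inscribed boxes\<close>

text \<open>
A coordinate strictly inside \<open>[-1/2, 1/2]\<close> can be moved both ways, so that the point is inside a segment
parallel to an edge.
\<close>

lemma parallelepiped_extreme_points:
  assumes "p extreme_point_of parallelepiped c u v w" and "u \<noteq> 0" "v \<noteq> 0" "w \<noteq> 0"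
  obtains x y z where "x \<in> {-1/2, 1/2}" "y \<in> {-1/2, 1/2}" "z \<in> {-1/2, 1/2}"
    "p = c + x *\<^sub>R u + y *\<^sub>R v + z *\<^sub>R w"
proof -
  have mid: "x \<in> {-1/2, 1/2}"
    if "p = P + x *\<^sub>R d" "x \<in> {-1/2..1/2}" "d \<noteq> 0"
      "\<And>x'. x' \<in> {-1/2..1/2} \<Longrightarrow> P + x' *\<^sub>R d \<in> parallelepiped c u v w" for P x d
  proof (rule ccontr)
    assume "x \<notin> {-1/2, 1/2}"
    then have x: "- 1/2 < x" "x < 1/2" using that(2) by auto
    have affine: "(1 - t) *\<^sub>R (P + r *\<^sub>R d) + t *\<^sub>R (P + s *\<^sub>R d) 
      = P + ((1 - t) * r + t * s) *\<^sub>R d" for r s t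
      by (simp add: algebra_simps)
    have "p \<in> open_segment (P + (-1/2) *\<^sub>R d) (P + (1/2) *\<^sub>R d)"
      unfolding in_segment
    proof (intro conjI exI [of _ "x + 1/2"])
      show "P + (-1/2) *\<^sub>R d \<noteq> P + (1/2) *\<^sub>R d"
        using \<open>d \<noteq> 0\<close> by simp
      show "p = (1 - (x + 1/2)) *\<^sub>R (P + (-1/2) *\<^sub>R d) + (x + 1/2) *\<^sub>R (P + (1/2) *\<^sub>R d)"
        unfolding that(1) affine by (simp add: field_simps)
    qed (use x in auto)
    moreover have "P + (-1/2) *\<^sub>R d \<in> parallelepiped c u v w" "P + (1/2) *\<^sub>R d \<in> parallelepiped c u v w"
      by (rule that(4), simp)+
    ultimately show False
      using assms(1) unfolding extreme_point_of_def by blast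
  qed
  obtain x y z where xyz: "x \<in> {-1/2..1/2}" "y \<in> {-1/2..1/2}" "z \<in> {-1/2..1/2}"
    and p: "p = c + x *\<^sub>R u + y *\<^sub>R v + z *\<^sub>R w"
    using assms(1) unfolding extreme_point_of_def parallelepiped_def by blast
  have mem: "c + x *\<^sub>R u + y *\<^sub>R v + z *\<^sub>R w \<in> parallelepiped c u v w"
    if "x \<in> {-1/2..1/2}" "y \<in> {-1/2..1/2}" "z \<in> {-1/2..1/2}" for x y z
    using that unfolding parallelepiped_def by blast
  have "x \<in> {-1/2, 1/2}"
    by (rule mid [of "c + y *\<^sub>R v + z *\<^sub>R w" x u])
      (use p xyz \<open>u \<noteq> 0\<close> mem [of _ y z] in \<open>auto simp: ac_simps\<close>)
  moreover have "y \<in> {-1/2, 1/2}"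
    by (rule mid [of "c + x *\<^sub>R u + z *\<^sub>R w" y v])
      (use p xyz \<open>v \<noteq> 0\<close> mem [of x _ z] in \<open>auto simp: ac_simps\<close>)
  moreover have "z \<in> {-1/2, 1/2}"
    by (rule mid [of "c + x *\<^sub>R u + y *\<^sub>R v" z w])
      (use p xyz \<open>w \<noteq> 0\<close> mem [of x y] in \<open>auto simp: ac_simps\<close>)
  ultimately show ?thesis using p that by blast
qed

text \<open>
The corners of the box with half axes \<open>u / r\<close>, \<open>v / r\<close>, \<open>q w / r\<close> are on the boundary if \<open>r\<close> is
the common value of the norm at the points \<open>\<plusminus>u \<plusminus> v \<plusminus> q w\<close>; this explains the edge length \<open>2 / r\<close>.
\<close>

theorem corollary11:
  fixes K :: "(real ^ 3) set" and c :: "real ^ 3" and q :: real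
  assumes "convex_body K"
    and "symmetric_about c K"
    and "q > 0"
  shows "\<exists>a B. a > 0 \<and> square_based_box B c a (q * a) \<and> inscribed B K"
proof -
  obtain \<rho> where "gauge_body ((+) (- c) ` K) \<rho>"
    and sym: "\<And>x. x \<in> (+) (- c) ` K \<Longrightarrow> - x \<in> (+) (- c) ` K"
    using symmetric_convex_body_gauge [OF assms(1,2)] by blast
  then interpret gauge_body "(+) (- c) ` K" \<rho> by simp
  let ?f = "minkowski_gauge ((+) (- c) ` K)"
  have even: "?f (- x) = ?f x" for x by (rule gauge_even [OF sym])
  obtain u v w where unit: "norm u = 1" "norm v = 1" "norm w = 1"
    and orth: "orthogonal u v" "orthogonal u w" "orthogonal v w"
    and eq: "?f (- u + v + q *\<^sub>R w) = ?f (u + v + q *\<^sub>R w)" "?f (- u - v + q *\<^sub>R w) = ?f (u + v + q *\<^sub>R w)"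
    "?f (u - v + q *\<^sub>R w) = ?f (u + v + q *\<^sub>R w)"
    using even_function_equal_on_square [OF continuous_gauge even] .
  have ne0: "x *\<^sub>R u + y *\<^sub>R v + z *\<^sub>R w \<noteq> 0" if "x \<noteq> 0" for x y z
  proof
    assume "x *\<^sub>R u + y *\<^sub>R v + z *\<^sub>R w = 0"
    then have "inner (x *\<^sub>R u + y *\<^sub>R v + z *\<^sub>R w) u = 0" by simp
    then show False
      using orth unit that by (simp add: inner_simps orthogonal_def inner_commute norm_eq_1)
  qed
  define r where "r = ?f (u + v + q *\<^sub>R w)"
  have "0 < r" unfolding r_def using ne0 [of 1 1 q] by (intro gauge_pos) simp
  have corner: "?f (x *\<^sub>R u + y *\<^sub>R v + (z * q) *\<^sub>R w) = r"
    if "x \<in> {-1, 1}" "y \<in> {-1, 1}" "z \<in> {-1, 1}" for x y z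
    using that eq eq [unfolded even [of "- u + v + q *\<^sub>R w", symmetric]
        even [of "- u - v + q *\<^sub>R w", symmetric] even [of "u - v + q *\<^sub>R w", symmetric]]
      even [of "u + v + q *\<^sub>R w"] unfolding r_def
    by (auto simp: algebra_simps)
  define a where "a = 2 / r"
  have "0 < a" unfolding a_def using \<open>0 < r\<close> by simp
  let ?B = "parallelepiped c (a *\<^sub>R u) (a *\<^sub>R v) ((q * a) *\<^sub>R w)"
  have "square_based_box ?B c a (q * a)"
    unfolding square_based_box_def box_with_edges_def
    using \<open>0 < a\<close> assms(3) unit orth
    by (intro conjI exI [of _ "a *\<^sub>R u"] exI [of _ "a *\<^sub>R v"] exI [of _ "(q * a) *\<^sub>R w"])
      (auto simp: orthogonal_def)
  moreover have "inscribed ?B K"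
    unfolding inscribed_def
  proof (intro allI impI)
    fix p assume p: "p extreme_point_of ?B"
    have "u \<noteq> 0" "v \<noteq> 0" "w \<noteq> 0" using unit by auto
    then obtain x y z where xyz: "x \<in> {-1/2, 1/2}" "y \<in> {-1/2, 1/2}" "z \<in> {-1/2, 1/2}"
      and p_eq: "p = c + x *\<^sub>R (a *\<^sub>R u) + y *\<^sub>R (a *\<^sub>R v) + z *\<^sub>R ((q * a) *\<^sub>R w)"
      using parallelepiped_extreme_points [OF p] \<open>0 < a\<close> assms(3) by auto
    let ?p = "(2 * x) *\<^sub>R u + (2 * y) *\<^sub>R v + (2 * z * q) *\<^sub>R w"
    have "?f ?p = r" by (rule corner) (use xyz in auto)
    moreover have "?p \<noteq> 0" by (rule ne0) (use xyz in auto)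
    ultimately have "?p /\<^sub>R r \<in> frontier ((+) (- c) ` K)"
      using scaled_in_frontier [of ?p] by simp
    moreover have "?p /\<^sub>R r = - c + p"
      unfolding p_eq a_def using \<open>0 < r\<close> by (simp add: algebra_simps divide_inverse)
    ultimately have "- c + p \<in> (+) (- c) ` frontier K"
      by (simp only: frontier_translation)
    then show "p \<in> frontier K" by auto
  qed
  ultimately show ?thesis using \<open>0 < a\<close> by blast
qed

end
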